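(* Let $n \ge 1$ be an integer and let $g \in Sp(2n;\mathbb{R})$ be a symplectic matrix. Let $\varphi_g \colon \mathbb{Z} \to Sp(2n;\mathbb{R})$ be the homomorphism defined by $\varphi_g(k) = g^k$. Then, under the identification $H_b^2(\mathbb{Z};\mathbb{Z}) \cong \mathbb{R}/\mathbb{Z}$ (induced by $r \mapsto -[\delta\beta_r]$, where $\beta_r(k) = \lfloor rk \rfloor$), the pullback by $\varphi_g$ of the bounded Euler class $e_b \in H_b^2(Sp(2n;\mathbb{R});\mathbb{Z})$ coincides with the symplectic rotation number of $g$, that is, $$\varphi_g^{*}(e_b) = \rho(g) \in \mathbb{R}/\mathbb{Z}.$$
   Context: **Bounded cohomology.** For a (discrete) group $G$ and $A = \mathbb{Z}$ or $\mathbb{R}$ (with the usual absolute value), let $C^k(G,A)$ be the group of all maps $G^k \to A$, with coboundary $\delta \colon C^k(G,A) \to C^{k+1}(G,A)$, $$\delta c(g_1,\ldots,g_{k+1}) = c(g_2,\ldots,g_{k+1}) + \sum_{i=1}^{k} (-1)^i c(g_1,\ldots,g_i g_{i+1},\ldots,g_{k+1}) + (-1)^{k+1} c(g_1,\ldots,g_k).$$ In particular $\delta f(g_1,g_2) = f(g_1) + f(g_2) - f(g_1 g_2)$ for $f \in C^1(G,A)$. The bounded cohomology $H_b^\bullet(G;A)$ is the cohomology of the subcomplex $C_b^\bullet(G,A)$ of bounded cochains; a homomorphism $\varphi$ induces a pullback $\varphi^*$ on it by composition of cochains with $\varphi$. **Quasi-morphisms.** A map $f \colon G \to \mathbb{R}$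 is a quasi-morphism if $\delta f$ is bounded; it is homogeneous if moreover $f(g^m) = m f(g)$ for all $g \in G$, $m \in \mathbb{Z}$. If $f \colon G \to \mathbb{Z}$ is a quasi-morphism, $\delta f$ is a bounded $2$-cocycle and defines a class $[\delta f] \in H_b^2(G;\mathbb{Z})$. **The identification $H_b^2(\mathbb{Z};\mathbb{Z}) \cong \mathbb{R}/\mathbb{Z}$.** For $r \in \mathbb{R}$ let $\beta_r \colon \mathbb{Z} \to \mathbb{Z}$, $\beta_r(k) = \lfloor rk \rfloor$; this is a quasi-morphism. It is known that $\mathbb{R} \to H_b^2(\mathbb{Z};\mathbb{Z})$, $r \mapsto -[\delta\beta_r]$, is a homomorphism inducing an isomorphism $\mathbb{R}/\mathbb{Z} \cong H_b^2(\mathbb{Z};\mathbb{Z})$. This is the identification used. **Symplectic translation and rotation numbers.** $Sp(2n;\mathbb{R})$ is the group of symplectic matrices for the standard symplectic form on $\mathbb{R}^{2n}$. Since $\pi_1(Sp(2n;\mathbb{R})) \cong \mathbb{Z}$, its universal covering group $p \colon \widetilde{Sp}(2n;\mathbb{R}) \to Sp(2n;\mathbb{R})$ gives a central extension $$0 \to \mathbb{Z} \xrightarrow{\,i\,} \widetilde{Sp}(2n;\mathbb{R}) \xrightarrow{\,p\,} Sp(2n;\mathbb{R}) \to 1.$$ It is known (Barge–Ghys) that there is a unique homogeneous quasi-morphism $\tau \colon \widetilde{Sp}(2n;\mathbb{R}) \to \mathbb{R}$ satisfying $\tau(\gamma \cdot i(a)) = \tau(\gamma) + a$ for all $\gamma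 \in \widetilde{Sp}(2n;\mathbb{R})$, $a \in \mathbb{Z}$. This $\tau$ is called the symplectic translation number. The symplectic rotation number $\rho \colon Sp(2n;\mathbb{R}) \to \mathbb{R}/\mathbb{Z}$ is $\rho(g) = \tau(\tilde g) \bmod \mathbb{Z}$ for any lift $\tilde g \in p^{-1}(g)$ (independent of the lift). **The bounded Euler class $e_b$.** The map $\lfloor \cdot \rfloor \circ \tau \colon \widetilde{Sp}(2n;\mathbb{R}) \to \mathbb{Z}$ is a quasi-morphism satisfying $\lfloor \tau(\gamma \cdot i(a)) \rfloor = \lfloor \tau(\gamma) \rfloor + a$. Hence (a known general fact) there is a unique $2$-cocycle $\sigma \colon Sp(2n;\mathbb{R})^2 \to \mathbb{Z}$ with $p^*\sigma = \delta(\lfloor \cdot \rfloor \circ \tau)$, i.e. $\sigma(p(\gamma_1),p(\gamma_2)) = \lfloor\tau(\gamma_1)\rfloor + \lfloor\tau(\gamma_2)\rfloor - \lfloor\tau(\gamma_1\gamma_2)\rfloor$, and $\sigma$ is bounded. The bounded Euler class is $e_b = [-\sigma] \in H_b^2(Sp(2n;\mathbb{R});\mathbb{Z})$. (Its image in $H^2(Sp(2n;\mathbb{R});\mathbb{Z})$ is the Euler class of the central extension $0 \to \mathbb{Z} \xrightarrow{\,i\,} \widetilde{Sp}(2n;\mathbb{R}) \xrightarrow{\,p\,} Sp(2n;\mathbb{R}) \to 1$ given by the universal covering group.) *)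

theory Defs
  imports "HOL-Analysis.Analysis" "HOL-Algebra.Elementary_Groups"
begin

section \<open>Bounded cohomology of a discrete group\<close>

definition tuples :: "('g, 'm) monoid_scheme \<Rightarrow> nat \<Rightarrow> 'g list set" where
  "tuples G k = {gs. set gs \<subseteq> carrier G \<and> length gs = k}"

text \<open>A map from \<open>G^k\<close> to the coefficients is a function on lists that vanishes outside the
  tuples of length \<open>k\<close> over the carrier, so that distinct functions are distinct cochains.  The
  coefficients are an ordered ring with absolute value; only \<open>int\<close> and \<open>real\<close> are used.\<close>

definition cochains :: "('g, 'm) monoid_scheme \<Rightarrow> nat \<Rightarrow> ('g list \<Rightarrow> 'a::linordered_idom) set" where
  "cochains G k = {c. \<forall>gs. gs \<notin> tuples G k \<longrightarrow> c gs = 0}"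

definition bounded_cochains ::
  "('g, 'm) monoid_scheme \<Rightarrow> nat \<Rightarrow> ('g list \<Rightarrow> 'a::linordered_idom) set" where
  "bounded_cochains G k = {c \<in> cochains G k. \<exists>B. \<forall>gs. \<bar>c gs\<bar> \<le> B}"

text \<open>The entry \<open>g\<^sub>i\<close> of the usual formula (indices starting at 1) is \<open>gs ! (i - 1)\<close>.\<close>

definition coboundary ::
  "('g, 'm) monoid_scheme \<Rightarrow> nat \<Rightarrow> ('g list \<Rightarrow> 'a::linordered_idom) \<Rightarrow> 'g list \<Rightarrow> 'a" where
  "coboundary G k c gs =
    (if gs \<in> tuples G (k + 1)
     then c (tl gs)
        + (\<Sum>i = 1..k. (- 1) ^ i *
             c (take (i - 1) gs @ [gs ! (i - 1) \<otimes>\<^bsub>G\<^esub> gs ! i] @ drop (i + 1) gs))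
        + (- 1) ^ (k + 1) * c (butlast gs)
     else 0)"

definition cocycles :: "('g, 'm) monoid_scheme \<Rightarrow> nat \<Rightarrow> ('g list \<Rightarrow> 'a::linordered_idom) set" where
  "cocycles G k = {c \<in> cochains G k. coboundary G k c = (\<lambda>_. 0)}"

definition bounded_cocycle_group ::
  "('g, 'm) monoid_scheme \<Rightarrow> nat \<Rightarrow> ('g list \<Rightarrow> 'a::linordered_idom) monoid" where
  "bounded_cocycle_group G k =
    \<lparr>carrier = cocycles G k \<inter> bounded_cochains G k,
     monoid.mult = (\<lambda>c d gs. c gs + d gs), one = (\<lambda>_. 0)\<rparr>"

definition bounded_coboundaries ::
  "('g, 'm) monoid_scheme \<Rightarrow> nat \<Rightarrow> ('g list \<Rightarrow> 'a::linordered_idom) set" where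
  "bounded_coboundaries G k =
    (case k of 0 \<Rightarrow> {\<lambda>_. 0} | Suc j \<Rightarrow> coboundary G j ` bounded_cochains G j)"

definition bounded_cohomology ::
  "('g, 'm) monoid_scheme \<Rightarrow> nat \<Rightarrow> ('g list \<Rightarrow> 'a::linordered_idom) set monoid" where
  "bounded_cohomology G k = bounded_cocycle_group G k Mod bounded_coboundaries G k"

definition cohomology_class ::
  "('g, 'm) monoid_scheme \<Rightarrow> nat \<Rightarrow> ('g list \<Rightarrow> 'a::linordered_idom) \<Rightarrow> ('g list \<Rightarrow> 'a) set" where
  "cohomology_class G k c = bounded_coboundaries G k #>\<^bsub>bounded_cocycle_group G k\<^esub> c"

definition cochain_pullback ::
  "('h, 'm) monoid_scheme \<Rightarrow> nat \<Rightarrow> ('h \<Rightarrow> 'g) \<Rightarrow> ('g list \<Rightarrow> 'a::linordered_idom) \<Rightarrow> 'h list \<Rightarrow> 'a" where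
  "cochain_pullback H k \<phi> c hs = (if hs \<in> tuples H k then c (map \<phi> hs) else 0)"

text \<open>The map induced on classes; \<open>the_elem\<close> selects the common value on all representatives,
  as in \<open>FactGroup_hom\<close>.\<close>

definition cohomology_pullback ::
  "('h, 'm) monoid_scheme \<Rightarrow> nat \<Rightarrow> ('h \<Rightarrow> 'g) \<Rightarrow>
    ('g list \<Rightarrow> 'a::linordered_idom) set \<Rightarrow> ('h list \<Rightarrow> 'a) set" where
  "cohomology_pullback H k \<phi> X =
    the_elem ((\<lambda>c. cohomology_class H k (cochain_pullback H k \<phi> c)) ` X)"


section \<open>Quasi-morphisms\<close>

definition cochain1 :: "('g, 'm) monoid_scheme \<Rightarrow> ('g \<Rightarrow> 'a::linordered_idom) \<Rightarrow> 'g list \<Rightarrow> 'a" where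
  "cochain1 G f gs = (if gs \<in> tuples G 1 then f (hd gs) else 0)"

definition quasi_morphism :: "('g, 'm) monoid_scheme \<Rightarrow> ('g \<Rightarrow> 'a::linordered_idom) \<Rightarrow> bool" where
  "quasi_morphism G f \<longleftrightarrow> coboundary G 1 (cochain1 G f) \<in> bounded_cochains G 2"

definition homogeneous_quasi_morphism :: "('g, 'm) monoid_scheme \<Rightarrow> ('g \<Rightarrow> real) \<Rightarrow> bool" where
  "homogeneous_quasi_morphism G f \<longleftrightarrow>
    quasi_morphism G f \<and> (\<forall>g\<in>carrier G. \<forall>m::int. f (g [^]\<^bsub>G\<^esub> m) = of_int m * f g)"


section \<open>The identification of the second bounded cohomology of the integers\<close>

definition real_add_group :: "real monoid" where
  "real_add_group = \<lparr>carrier = UNIV, monoid.mult = (+), one = 0\<rparr>"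

definition real_mod_int :: "real set monoid" where
  "real_mod_int = real_add_group Mod \<int>"

definition class_mod_int :: "real \<Rightarrow> real set" where
  "class_mod_int r = \<int> #>\<^bsub>real_add_group\<^esub> r"

definition floor_mult :: "real \<Rightarrow> int \<Rightarrow> int" where
  "floor_mult r k = \<lfloor>r * of_int k\<rfloor>"

definition real_to_Hb2_int :: "real \<Rightarrow> (int list \<Rightarrow> int) set" where
  "real_to_Hb2_int r =
    inv\<^bsub>bounded_cohomology integer_group 2\<^esub>
      (cohomology_class integer_group 2 (coboundary integer_group 1 (cochain1 integer_group (floor_mult r))))"

definition real_mod_int_to_Hb2_int :: "real set \<Rightarrow> (int list \<Rightarrow> int) set" where
  "real_mod_int_to_Hb2_int X = the_elem (real_to_Hb2_int ` X)"

definition Hb2_int_to_real_mod_int :: "(int list \<Rightarrow> int) set \<Rightarrow> real set" where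
  "Hb2_int_to_real_mod_int = inv_into (carrier real_mod_int) real_mod_int_to_Hb2_int"


section \<open>The symplectic group and its universal covering group\<close>

text \<open>The standard symplectic space of dimension \<open>2n\<close>, \<open>n = CARD('n)\<close>: the coordinates indexed by
  \<open>Inl i\<close> and \<open>Inr i\<close> form conjugate pairs.\<close>

definition symplectic_form :: "real^('n::finite + 'n) \<Rightarrow> real^('n + 'n) \<Rightarrow> real" where
  "symplectic_form x y = (\<Sum>i\<in>UNIV. x $ Inl i * y $ Inr i - x $ Inr i * y $ Inl i)"

definition Sp :: "(real^('n::finite + 'n)^('n + 'n)) monoid" where
  "Sp = \<lparr>carrier = {A. \<forall>x y. symplectic_form (A *v x) (A *v y) = symplectic_form x y},
         monoid.mult = (**), one = mat 1\<rparr>"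

text \<open>The carrier of a topological group has the subspace topology of the ambient type.\<close>

definition topological_group :: "('e::topological_space, 'm) monoid_scheme \<Rightarrow> bool" where
  "topological_group E \<longleftrightarrow> group E
     \<and> continuous_on (carrier E \<times> carrier E) (\<lambda>(x, y). x \<otimes>\<^bsub>E\<^esub> y)
     \<and> continuous_on (carrier E) (\<lambda>x. inv\<^bsub>E\<^esub> x)"

definition universal_covering_group ::
  "('e::topological_space, 'm) monoid_scheme \<Rightarrow> ('e \<Rightarrow> 'g) \<Rightarrow> ('g::topological_space, 'l) monoid_scheme \<Rightarrow> bool" where
  "universal_covering_group E p G \<longleftrightarrow> topological_group E \<and> p \<in> hom E G
     \<and> covering_space (carrier E) p (carrier G) \<and> simply_connected (carrier E)"

definition central_extension_by_int ::
  "(int \<Rightarrow> 'e) \<Rightarrow> ('e, 'm) monoid_scheme \<Rightarrow> ('e \<Rightarrow> 'g) \<Rightarrow> ('g, 'l) monoid_scheme \<Rightarrow> bool" where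
  "central_extension_by_int i E p G \<longleftrightarrow>
     i \<in> hom integer_group E \<and> inj i \<and> p \<in> hom E G \<and> p ` carrier E = carrier G
     \<and> range i = kernel E G p
     \<and> (\<forall>a. \<forall>\<gamma>\<in>carrier E. i a \<otimes>\<^bsub>E\<^esub> \<gamma> = \<gamma> \<otimes>\<^bsub>E\<^esub> i a)"


section \<open>Translation number, rotation number and bounded Euler class\<close>

text \<open>On the universal covering group of the symplectic group the translation number is
  unique (Barge--Ghys).\<close>

definition translation_number ::
  "('e, 'm) monoid_scheme \<Rightarrow> (int \<Rightarrow> 'e) \<Rightarrow> ('e \<Rightarrow> real) \<Rightarrow> bool" where
  "translation_number E i \<tau> \<longleftrightarrow> homogeneous_quasi_morphism E \<tau>
     \<and> (\<forall>\<gamma>\<in>carrier E. \<forall>a. \<tau> (\<gamma> \<otimes>\<^bsub>E\<^esub> i a) = \<tau> \<gamma> + of_int a)"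

definition rotation_number ::
  "('e, 'm) monoid_scheme \<Rightarrow> ('e \<Rightarrow> 'g) \<Rightarrow> ('e \<Rightarrow> real) \<Rightarrow> 'g \<Rightarrow> real set" where
  "rotation_number E p \<tau> g = the_elem ((\<lambda>\<gamma>. class_mod_int (\<tau> \<gamma>)) ` {\<gamma> \<in> carrier E. p \<gamma> = g})"

definition euler_cocycle ::
  "('e, 'm) monoid_scheme \<Rightarrow> ('e \<Rightarrow> 'g) \<Rightarrow> ('g, 'l) monoid_scheme \<Rightarrow> ('e \<Rightarrow> real) \<Rightarrow> 'g list \<Rightarrow> int" where
  "euler_cocycle E p G \<tau> = (THE \<sigma>. \<sigma> \<in> cocycles G 2 \<and>
     cochain_pullback E 2 p \<sigma> = coboundary E 1 (cochain1 E (\<lambda>\<gamma>. \<lfloor>\<tau> \<gamma>\<rfloor>)))"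

definition bounded_euler_class ::
  "('e, 'm) monoid_scheme \<Rightarrow> ('e \<Rightarrow> 'g) \<Rightarrow> ('g, 'l) monoid_scheme \<Rightarrow> ('e \<Rightarrow> real) \<Rightarrow> ('g list \<Rightarrow> int) set" where
  "bounded_euler_class E p G \<tau> = cohomology_class G 2 (\<lambda>gs. - euler_cocycle E p G \<tau> gs)"


section \<open>The identification is a well-defined isomorphism\<close>

lemma tuples_Suc: "tuples G (Suc k) = {x # xs | x xs. x \<in> carrier G \<and> xs \<in> tuples G k}"
  by (auto simp: tuples_def length_Suc_conv)

lemma tuples_0: "tuples G 0 = {[]}"
  by (auto simp: tuples_def)

lemma cochain1_bounded_cochains:
  fixes c :: "'g list \<Rightarrow> 'a::linordered_idom"
  shows "c \<in> bounded_cochains G 1 \<longleftrightarrow> (\<exists>f. c = cochain1 G f \<and> (\<exists>B. \<forall>x\<in>carrier G. \<bar>f x\<bar> \<le> B))"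
proof
  assume c: "c \<in> bounded_cochains G 1"
  then obtain B where B: "\<forall>gs. \<bar>c gs\<bar> \<le> B"
    by (auto simp: bounded_cochains_def)
  have "c = cochain1 G (\<lambda>x. c [x])"
    using c by (auto simp: fun_eq_iff cochain1_def bounded_cochains_def cochains_def tuples_Suc tuples_0)
  then show "\<exists>f. c = cochain1 G f \<and> (\<exists>B. \<forall>x\<in>carrier G. \<bar>f x\<bar> \<le> B)"
    using B by blast
next
  assume "\<exists>f. c = cochain1 G f \<and> (\<exists>B. \<forall>x\<in>carrier G. \<bar>f x\<bar> \<le> B)"
  then obtain f B where f: "c = cochain1 G f" "\<forall>x\<in>carrier G. \<bar>f x\<bar> \<le> B"
    by blast
  then have "\<forall>gs. \<bar>c gs\<bar> \<le> max 0 B"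
    by (auto simp: cochain1_def tuples_Suc tuples_0 le_max_iff_disj)
  moreover have "c \<in> cochains G 1"
    using f by (auto simp: cochains_def cochain1_def)
  ultimately show "c \<in> bounded_cochains G 1"
    unfolding bounded_cochains_def by blast
qed

lemma coboundary_cochain1:
  assumes "group G"
  shows "coboundary G 1 (cochain1 G f) gs =
    (if gs \<in> tuples G 2 then f (gs ! 0) + f (gs ! 1) - f (gs ! 0 \<otimes>\<^bsub>G\<^esub> gs ! 1) else 0)"
proof -
  interpret group G by fact
  show ?thesis
    by (auto simp: coboundary_def cochain1_def tuples_Suc tuples_0 numeral_2_eq_2)
qed

lemmas coboundary_cochain1_Suc = coboundary_cochain1[unfolded One_nat_def]

lemma coboundary_2:
  "coboundary G 2 c gs = (if gs \<in> tuples G 3 then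
     c [gs ! 1, gs ! 2] - c [gs ! 0 \<otimes>\<^bsub>G\<^esub> gs ! 1, gs ! 2] + c [gs ! 0, gs ! 1 \<otimes>\<^bsub>G\<^esub> gs ! 2] - c [gs ! 0, gs ! 1]
     else 0)"
proof (cases "gs \<in> tuples G 3")
  case True
  then obtain x y z where "gs = [x, y, z]"
    by (auto simp: tuples_def numeral_3_eq_3 length_Suc_conv)
  moreover have "{1..2::nat} = {1, 2}" by auto
  ultimately show ?thesis
    using True by (simp add: coboundary_def)
qed (simp add: coboundary_def)

lemma coboundary_cochain1_cocycle:
  fixes f :: "'g \<Rightarrow> 'a::linordered_idom"
  assumes "group G"
  shows "coboundary G 1 (cochain1 G f) \<in> cocycles G 2"
proof -
  interpret group G by fact
  have "coboundary G 1 (cochain1 G f) \<in> cochains G 2"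
    by (auto simp: cochains_def coboundary_cochain1_Suc[OF assms])
  moreover have "coboundary G 2 (coboundary G 1 (cochain1 G f)) gs = 0" for gs
    unfolding coboundary_2 coboundary_cochain1[OF assms]
    by (auto simp: tuples_Suc tuples_0 numeral_2_eq_2 numeral_3_eq_3 m_assoc)
  ultimately show ?thesis
    by (auto simp: cocycles_def)
qed

lemma coboundary_add: "coboundary G k (\<lambda>x. c x + d x) gs = coboundary G k c gs + coboundary G k d gs"
  by (simp add: coboundary_def sum.distrib algebra_simps)

lemma coboundary_minus: "coboundary G k (\<lambda>x. - c x) gs = - coboundary G k c gs"
  by (simp add: coboundary_def sum_negf algebra_simps)

lemma bounded_cochains_add:
  assumes "c \<in> bounded_cochains G k" "d \<in> bounded_cochains G k"
  shows "(\<lambda>x. c x + d x) \<in> bounded_cochains G k"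
proof -
  obtain B C where "\<forall>gs. \<bar>c gs\<bar> \<le> B" "\<forall>gs. \<bar>d gs\<bar> \<le> C"
    using assms by (auto simp: bounded_cochains_def)
  then have "\<bar>c gs + d gs\<bar> \<le> B + C" for gs
    by (meson abs_triangle_ineq add_mono order_trans)
  then show ?thesis
    using assms by (auto simp: bounded_cochains_def cochains_def)
qed

lemma bounded_cochains_minus:
  "c \<in> bounded_cochains G k \<Longrightarrow> (\<lambda>x. - c x) \<in> bounded_cochains G k"
  by (auto simp: bounded_cochains_def cochains_def)

lemma bounded_cochains_zero: "(\<lambda>_. 0) \<in> bounded_cochains G k"
  by (auto simp: bounded_cochains_def cochains_def)

lemma cocycles_add: "c \<in> cocycles G k \<Longrightarrow> d \<in> cocycles G k \<Longrightarrow> (\<lambda>x. c x + d x) \<in> cocycles G k"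
  by (auto simp: cocycles_def cochains_def coboundary_add fun_eq_iff)

lemma cocycles_minus: "c \<in> cocycles G k \<Longrightarrow> (\<lambda>x. - c x) \<in> cocycles G k"
  by (auto simp: cocycles_def cochains_def coboundary_minus fun_eq_iff)

lemma cocycles_zero: "(\<lambda>_. 0) \<in> cocycles G k"
  by (auto simp: cocycles_def cochains_def coboundary_def fun_eq_iff)

lemma comm_group_bounded_cocycle_group:
  "comm_group (bounded_cocycle_group G k :: ('g list \<Rightarrow> 'a::linordered_idom) monoid)"
proof (rule comm_groupI)
  fix c assume "c \<in> carrier (bounded_cocycle_group G k :: ('g list \<Rightarrow> 'a) monoid)"
  then show "\<exists>d\<in>carrier (bounded_cocycle_group G k).
      d \<otimes>\<^bsub>bounded_cocycle_group G k\<^esub> c = \<one>\<^bsub>bounded_cocycle_group G k\<^esub>"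
    by (intro bexI[of _ "\<lambda>x. - c x"])
      (auto simp: bounded_cocycle_group_def cocycles_minus bounded_cochains_minus)
qed (auto simp: bounded_cocycle_group_def cocycles_add bounded_cochains_add cocycles_zero
    bounded_cochains_zero add_ac)

lemma inv_bounded_cocycle_group:
  assumes "c \<in> carrier (bounded_cocycle_group G k)"
  shows "inv\<^bsub>bounded_cocycle_group G k\<^esub> c = (\<lambda>x. - c x)"
proof -
  interpret comm_group "bounded_cocycle_group G k :: ('a list \<Rightarrow> 'b) monoid"
    by (rule comm_group_bounded_cocycle_group)
  show ?thesis
    using assms
    by (intro inv_equality) (auto simp: bounded_cocycle_group_def cocycles_minus bounded_cochains_minus)
qed

lemma bounded_coboundaries_2:
  "bounded_coboundaries G 2 = coboundary G 1 ` bounded_cochains G 1"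
  by (simp add: bounded_coboundaries_def numeral_2_eq_2)

lemma bounded_coboundaries_2_iff:
  "c \<in> bounded_coboundaries G 2 \<longleftrightarrow>
    (\<exists>f. c = coboundary G 1 (cochain1 G f) \<and> (\<exists>B. \<forall>x\<in>carrier G. \<bar>f x\<bar> \<le> B))"
  unfolding bounded_coboundaries_2 cochain1_bounded_cochains image_iff Bex_def by blast

lemma bounded_coboundary_cocycle:
  fixes f :: "'g \<Rightarrow> 'a::linordered_idom"
  assumes "group G" "\<forall>x\<in>carrier G. \<bar>f x\<bar> \<le> B"
  shows "quasi_morphism G f"
proof -
  interpret group G by fact
  have "\<bar>f x + f y - f (x \<otimes>\<^bsub>G\<^esub> y)\<bar> \<le> B + B + B" if "x \<in> carrier G" "y \<in> carrier G" for x y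
    using assms(2)[rule_format, of x] assms(2)[rule_format, of y]
      assms(2)[rule_format, of "x \<otimes>\<^bsub>G\<^esub> y"] that by auto
  then have "\<bar>coboundary G 1 (cochain1 G f) gs\<bar> \<le> max 0 (B + B + B)" for gs
    by (auto simp: coboundary_cochain1_Suc[OF assms(1)] tuples_Suc tuples_0 numeral_2_eq_2 le_max_iff_disj)
  then show ?thesis
    using coboundary_cochain1_cocycle[OF assms(1), of f]
    unfolding quasi_morphism_def bounded_cochains_def cocycles_def by blast
qed

lemma normal_bounded_coboundaries_2:
  assumes "group G"
  shows "(bounded_coboundaries G 2 :: ('g list \<Rightarrow> 'a::linordered_idom) set) \<lhd> bounded_cocycle_group G 2"
proof -
  interpret comm_group "bounded_cocycle_group G 2 :: ('g list \<Rightarrow> 'a) monoid"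
    by (rule comm_group_bounded_cocycle_group)
  have sub: "bounded_coboundaries G 2 \<subseteq> carrier (bounded_cocycle_group G 2 :: ('g list \<Rightarrow> 'a) monoid)"
    using bounded_coboundary_cocycle[OF assms] coboundary_cochain1_cocycle[OF assms]
    by (auto simp: bounded_coboundaries_2_iff bounded_cocycle_group_def quasi_morphism_def)
  have "subgroup (bounded_coboundaries G 2) (bounded_cocycle_group G 2 :: ('g list \<Rightarrow> 'a) monoid)"
  proof (rule subgroupI)
    show "bounded_coboundaries G 2 \<noteq> ({} :: ('g list \<Rightarrow> 'a) set)"
      using bounded_cochains_zero by (auto simp: bounded_coboundaries_2)
  next
    fix c :: "'g list \<Rightarrow> 'a" assume c: "c \<in> bounded_coboundaries G 2"
    then obtain d where "d \<in> bounded_cochains G 1" "c = coboundary G 1 d"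
      by (auto simp: bounded_coboundaries_2)
    then have "inv\<^bsub>bounded_cocycle_group G 2\<^esub> c = coboundary G 1 (\<lambda>x. - d x)"
      using c sub by (subst inv_bounded_cocycle_group) (auto simp: fun_eq_iff coboundary_minus)
    then show "inv\<^bsub>bounded_cocycle_group G 2\<^esub> c \<in> bounded_coboundaries G 2"
      using bounded_cochains_minus[OF \<open>d \<in> _\<close>] by (simp add: bounded_coboundaries_2)
  next
    fix c c' :: "'g list \<Rightarrow> 'a"
    assume "c \<in> bounded_coboundaries G 2" "c' \<in> bounded_coboundaries G 2"
    then obtain d d' where d: "d \<in> bounded_cochains G 1" "c = coboundary G 1 d"
      "d' \<in> bounded_cochains G 1" "c' = coboundary G 1 d'"
      by (auto simp: bounded_coboundaries_2)
    then have "(\<lambda>gs. c gs + c' gs) = coboundary G 1 (\<lambda>x. d x + d' x)"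
      by (simp add: fun_eq_iff coboundary_add)
    then show "c \<otimes>\<^bsub>bounded_cocycle_group G 2\<^esub> c' \<in> bounded_coboundaries G 2"
      using bounded_cochains_add[OF d(1,3)] by (simp add: bounded_cocycle_group_def bounded_coboundaries_2)
  qed (use sub in auto)
  then show ?thesis
    by (rule subgroup_imp_normal)
qed

lemma group_bounded_cohomology_2:
  assumes "group G" shows "group (bounded_cohomology G 2)"
  unfolding bounded_cohomology_def by (rule normal.factorgroup_is_group[OF normal_bounded_coboundaries_2[OF assms]])

lemma floor_mult_bounds: "of_int (floor_mult r k) \<le> r * of_int k" "r * of_int k < of_int (floor_mult r k) + 1"
  unfolding floor_mult_def by linarith+

lemma quasi_morphism_floor_mult: "quasi_morphism integer_group (floor_mult r)"
proof -
  have "\<bar>floor_mult r x + floor_mult r y - floor_mult r (x + y)\<bar> \<le> 2" for x y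
    using floor_mult_bounds[of r x] floor_mult_bounds[of r y] floor_mult_bounds[of r "x + y"]
    unfolding of_int_add distrib_left by linarith
  then have "\<bar>coboundary integer_group 1 (cochain1 integer_group (floor_mult r)) gs\<bar> \<le> 2" for gs
    by (auto simp: coboundary_cochain1_Suc)
  then show ?thesis
    using coboundary_cochain1_cocycle[OF group_integer_group, of "floor_mult r"]
    unfolding quasi_morphism_def bounded_cochains_def cocycles_def by blast
qed

definition floor_cocycle :: "real \<Rightarrow> int list \<Rightarrow> int" where
  "floor_cocycle r = coboundary integer_group 1 (cochain1 integer_group (floor_mult r))"

lemma floor_cocycle_apply:
  "floor_cocycle r gs = (if gs \<in> tuples integer_group 2 then
     floor_mult r (gs ! 0) + floor_mult r (gs ! 1) - floor_mult r (gs ! 0 + gs ! 1) else 0)"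
  by (simp add: floor_cocycle_def coboundary_cochain1_Suc)

lemma floor_cocycle_carrier: "floor_cocycle r \<in> carrier (bounded_cocycle_group integer_group 2)"
  using quasi_morphism_floor_mult[of r] coboundary_cochain1_cocycle[OF group_integer_group, of "floor_mult r"]
  by (auto simp: floor_cocycle_def quasi_morphism_def bounded_cocycle_group_def)

lemma cohomology_class_eq_iff:
  fixes c d :: "'g list \<Rightarrow> 'a::linordered_idom"
  assumes "group G" "c \<in> carrier (bounded_cocycle_group G 2)" "d \<in> carrier (bounded_cocycle_group G 2)"
  shows "cohomology_class G 2 c = cohomology_class G 2 d \<longleftrightarrow> (\<lambda>x. c x - d x) \<in> bounded_coboundaries G 2"
proof -
  interpret normal "bounded_coboundaries G 2 :: ('g list \<Rightarrow> 'a) set" "bounded_cocycle_group G 2"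
    by (rule normal_bounded_coboundaries_2) fact
  have *: "cohomology_class G 2 c = {x. \<exists>h \<in> bounded_coboundaries G 2. x = (\<lambda>gs. h gs + c gs)}" for c :: "'g list \<Rightarrow> 'a"
    by (auto simp: cohomology_class_def r_coset_def bounded_cocycle_group_def)
  have "cohomology_class G 2 c = cohomology_class G 2 d \<longleftrightarrow> c \<in> cohomology_class G 2 d"
    unfolding cohomology_class_def
    by (metis assms(2,3) rcos_self repr_independence subgroup_axioms)
  also have "\<dots> \<longleftrightarrow> (\<lambda>x. c x - d x) \<in> bounded_coboundaries G 2"
    unfolding * by (auto simp: fun_eq_iff intro!: bexI[of _ "\<lambda>x. c x - d x"])
  finally show ?thesis .
qed

lemma cohomology_class_uminus:
  fixes c :: "'g list \<Rightarrow> 'a::linordered_idom"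
  assumes "group G" "c \<in> carrier (bounded_cocycle_group G 2)"
  shows "inv\<^bsub>bounded_cohomology G 2\<^esub> (cohomology_class G 2 c) = cohomology_class G 2 (\<lambda>x. - c x)"
proof -
  interpret normal "bounded_coboundaries G 2 :: ('g list \<Rightarrow> 'a) set" "bounded_cocycle_group G 2"
    by (rule normal_bounded_coboundaries_2) fact
  show ?thesis
    unfolding bounded_cohomology_def cohomology_class_def
    using assms rcos_inv[of c] inv_bounded_cocycle_group[of c G 2]
    by (subst inv_FactGroup) (auto simp: FactGroup_def RCOSETS_def)
qed

lemma real_to_Hb2_int_eq: "real_to_Hb2_int r = cohomology_class integer_group 2 (\<lambda>x. - floor_cocycle r x)"
  unfolding real_to_Hb2_int_def floor_cocycle_def[symmetric]
  by (rule cohomology_class_uminus[OF group_integer_group floor_cocycle_carrier])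

lemma minus_floor_cocycle_carrier:
  "(\<lambda>x. - floor_cocycle r x) \<in> carrier (bounded_cocycle_group integer_group 2)"
  using floor_cocycle_carrier[of r]
  by (auto simp: bounded_cocycle_group_def intro: cocycles_minus bounded_cochains_minus)

lemma bounded_homogeneous_zero:
  fixes s :: real
  assumes "\<And>k::int. \<bar>s * of_int k\<bar> \<le> B"
  shows "s = 0"
proof (rule ccontr)
  assume "s \<noteq> 0"
  obtain n :: nat where "B / \<bar>s\<bar> < of_nat n"
    using reals_Archimedean2 by blast
  with \<open>s \<noteq> 0\<close> assms[of "int n"] show False
    by (simp add: abs_mult field_simps)
qed

lemma int_additive:
  fixes f :: "int \<Rightarrow> int"
  assumes "\<And>x y. f (x + y) = f x + f y"
  shows "f k = f 1 * k"
proof -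
  have 0: "f 0 = 0" using assms[of 0 0] by simp
  show ?thesis
  proof (induction k rule: int_induct[where k = 0])
    case (step2 k)
    with assms[of "k - 1" 1] show ?case by (simp add: algebra_simps)
  qed (simp_all add: 0 assms algebra_simps)
qed

lemma real_to_Hb2_int_eq_one_iff:
  "real_to_Hb2_int r = bounded_coboundaries integer_group 2 \<longleftrightarrow> r \<in> \<int>"
proof -
  let ?Z = integer_group
  interpret normal "bounded_coboundaries ?Z 2 :: (int list \<Rightarrow> int) set" "bounded_cocycle_group ?Z 2"
    by (rule normal_bounded_coboundaries_2) simp
  have "real_to_Hb2_int r = bounded_coboundaries ?Z 2 \<longleftrightarrow> (\<lambda>x. - floor_cocycle r x) \<in> bounded_coboundaries ?Z 2"
    unfolding real_to_Hb2_int_eq cohomology_class_def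
    by (metis coset_join1 coset_join2 minus_floor_cocycle_carrier subgroup_axioms subset is_group rcos_self)
  also have "\<dots> \<longleftrightarrow> r \<in> \<int>"
  proof
    assume "(\<lambda>x. - floor_cocycle r x) \<in> bounded_coboundaries ?Z 2"
    then obtain f B where f: "(\<lambda>x. - floor_cocycle r x) = coboundary ?Z 1 (cochain1 ?Z f)"
      and B: "\<And>x. \<bar>f x\<bar> \<le> B"
      unfolding bounded_coboundaries_2_iff by auto
    define u where "u k = floor_mult r k + f k" for k
    have "u (x + y) = u x + u y" for x y
      using fun_cong[OF f, of "[x, y]"]
      by (simp add: floor_cocycle_apply coboundary_cochain1_Suc tuples_def u_def)
    then have u: "u k = u 1 * k" for k
      by (rule int_additive)
    have "\<bar>(r - of_int (u 1)) * of_int k\<bar> \<le> of_int B + 1" for k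
    proof -
      have "(r - of_int (u 1)) * of_int k = r * of_int k - of_int (u k)"
        by (subst u) (simp add: algebra_simps)
      then show ?thesis
        using floor_mult_bounds[of r k] B[of k] unfolding u_def of_int_add
        by linarith
    qed
    then have "r - of_int (u 1) = 0"
      by (rule bounded_homogeneous_zero)
    then show "r \<in> \<int>"
      by (metis Ints_of_int eq_iff_diff_eq_0)
  next
    assume "r \<in> \<int>"
    then obtain m where "r = of_int m" by (auto elim: Ints_cases)
    then have "floor_mult r k = m * k" for k
      by (simp add: floor_mult_def flip: of_int_mult)
    then have "(\<lambda>x. - floor_cocycle r x) = \<one>\<^bsub>bounded_cocycle_group ?Z 2\<^esub>"
      by (auto simp: floor_cocycle_apply fun_eq_iff bounded_cocycle_group_def algebra_simps)
    then show "(\<lambda>x. - floor_cocycle r x) \<in> bounded_coboundaries ?Z 2"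
      using one_closed by simp
  qed
  finally show ?thesis .
qed

lemma int_antidifference:
  fixes s :: "int \<Rightarrow> int"
  shows "\<exists>f. f 0 = a \<and> (\<forall>x. f (x + 1) = f x - s x)"
proof -
  define f where "f x = a - (\<Sum>j\<in>{0..<x}. s j) + (\<Sum>j\<in>{x..<0}. s j)" for x
  have "f (x + 1) = f x - s x" for x
  proof (cases "x \<ge> 0")
    case True
    then have "{0..<x + 1} = insert x {0..<x}" by auto
    with True show ?thesis by (simp add: f_def)
  next
    case False
    then have "{x..<0} = insert x {x + 1..<0}" by auto
    with False show ?thesis by (simp add: f_def)
  qed
  moreover have "f 0 = a" by (simp add: f_def)
  ultimately show ?thesis by blast
qed

lemma int_cocycle_coboundary:
  fixes c :: "int list \<Rightarrow> int"
  assumes "c \<in> cocycles integer_group 2"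
  shows "\<exists>f. c = coboundary integer_group 1 (cochain1 integer_group f)"
proof -
  have coc: "c [y, z] - c [x + y, z] + c [x, y + z] - c [x, y] = 0" for x y z
  proof -
    have "coboundary integer_group 2 c [x, y, z] = 0"
      using assms by (simp add: cocycles_def)
    then show ?thesis
      by (simp add: coboundary_2 tuples_def)
  qed
  obtain f where f: "f 0 = c [0, 0]" "\<And>x. f (x + 1) = f x - c [x, 1]"
    using int_antidifference[of "c [0, 0]" "\<lambda>x. c [x, 1]"] by blast
  have "c [x, y] = f x + f y - f (x + y)" for x y
  proof (induction y rule: int_induct[where k = 0])
    case base
    then show ?case using coc[where x = x and y = 0 and z = 0] f(1) by simp
  next
    case (step1 y)
    then show ?case using coc[where x = x and y = y and z = 1] f(2)[of y] f(2)[of "x + y"]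
      by (simp add: algebra_simps)
  next
    case (step2 y)
    then show ?case
      using coc[where x = x and y = "y - 1" and z = 1] f(2)[of "y - 1"] f(2)[of "x + (y - 1)"]
      by (simp add: algebra_simps)
  qed
  moreover have "c gs = 0" if "gs \<notin> tuples integer_group 2" for gs
    using assms that by (simp add: cocycles_def cochains_def)
  ultimately have "c = coboundary integer_group 1 (cochain1 integer_group f)"
    by (auto simp: fun_eq_iff coboundary_cochain1_Suc tuples_Suc tuples_0 numeral_2_eq_2)
  then show ?thesis by blast
qed

lemma int_quasi_morphism_slope:
  fixes f :: "int \<Rightarrow> int"
  assumes D: "\<And>x y. \<bar>f x + f y - f (x + y)\<bar> \<le> D"
  shows "\<exists>r B. \<forall>k. \<bar>f k - floor_mult r k\<bar> \<le> B"
proof -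
  have D0: "D \<ge> 0" using D[of 0 0] by linarith
  have mult: "\<bar>f (int m * k) - int m * f k\<bar> \<le> int m * D" if "m \<ge> 1" for m k
    using that
  proof (induction m rule: dec_induct)
    case base
    then show ?case using D0 by simp
  next
    case (step m)
    then show ?case using D[of k "int m * k"] by (simp add: algebra_simps)
  qed
  have key: "(of_int (f (int m)) - of_int D) / real m \<le> (of_int (f (int n)) + of_int D) / real n"
    if "m \<ge> 1" "n \<ge> 1" for m n
  proof -
    have "int n * f (int m) - int n * D \<le> int m * f (int n) + int m * D"
      using mult[OF that(1), of "int n"] mult[OF that(2), of "int m"] by (simp add: mult.commute)
    then have "real_of_int (int n * f (int m) - int n * D) \<le> of_int (int m * f (int n) + int m * D)"
      by (simp only: of_int_le_iff)
    then show ?thesis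
      using that by (simp add: field_simps)
  qed
  define r where "r = (SUP m\<in>{1::nat..}. (of_int (f (int m)) - of_int D) / real m)"
  have bdd: "bdd_above ((\<lambda>m. (of_int (f (int m)) - of_int D) / real m) ` {1::nat..})"
    using key[where n = 1] by (intro bdd_aboveI2) auto
  have pos: "\<bar>of_int (f (int n)) - r * real n\<bar> \<le> of_int D" if "n \<ge> 1" for n
  proof -
    have "(of_int (f (int n)) - of_int D) / real n \<le> r"
      unfolding r_def using that by (intro cSUP_upper bdd) auto
    moreover have "r \<le> (of_int (f (int n)) + of_int D) / real n"
      unfolding r_def using that key by (intro cSUP_least) auto
    ultimately show ?thesis
      using that by (auto simp: field_simps abs_le_iff)
  qed
  have all: "\<bar>of_int (f k) - r * of_int k\<bar> \<le> 3 * real_of_int D" for k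
  proof -
    have f0: "\<bar>f 0\<bar> \<le> D" using D[of 0 0] by simp
    consider "k = 0" | "k \<ge> 1" | "k \<le> -1" by linarith
    then show ?thesis
    proof cases
      case 1
      then show ?thesis using f0 by simp
    next
      case 2
      then have "\<bar>of_int (f k) - r * of_int k\<bar> \<le> real_of_int D"
        using pos[of "nat k"] by (simp add: nat_le_iff le_nat_iff)
      with D0 show ?thesis by linarith
    next
      case 3
      have "\<bar>f k + f (- k) - f 0\<bar> \<le> D" using D[of k "- k"] by simp
      with f0 have "\<bar>f k + f (- k)\<bar> \<le> 2 * D" by linarith
      then have "\<bar>of_int (f k) + of_int (f (- k))\<bar> \<le> 2 * real_of_int D"
        by (metis of_int_abs of_int_add of_int_le_iff of_int_mult of_int_numeral)
      moreover have "\<bar>of_int (f (- k)) + r * of_int k\<bar> \<le> of_int D"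
        using 3 pos[of "nat (- k)"] by (simp add: le_nat_iff)
      ultimately show ?thesis by linarith
    qed
  qed
  have "\<bar>f k - floor_mult r k\<bar> \<le> 3 * D + 1" for k
  proof -
    have "\<bar>real_of_int (f k - floor_mult r k)\<bar> \<le> of_int (3 * D + 1)"
      unfolding of_int_diff of_int_add of_int_mult
      using all[of k] floor_mult_bounds[of r k] by simp
    then show ?thesis by linarith
  qed
  then show ?thesis by blast
qed

lemma group_hom_real_to_Hb2_int:
  "group_hom real_add_group (bounded_cohomology integer_group 2) real_to_Hb2_int"
proof -
  let ?Z = integer_group
  interpret N: normal "bounded_coboundaries ?Z 2 :: (int list \<Rightarrow> int) set" "bounded_cocycle_group ?Z 2"
    by (rule normal_bounded_coboundaries_2) simp
  have "real_to_Hb2_int (r + s) =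
      real_to_Hb2_int r \<otimes>\<^bsub>bounded_cohomology ?Z 2\<^esub> real_to_Hb2_int s" for r s
  proof -
    let ?c = "\<lambda>x. - floor_cocycle r x + - floor_cocycle s x"
    have mult: "(\<lambda>x. - floor_cocycle r x) \<otimes>\<^bsub>bounded_cocycle_group ?Z 2\<^esub> (\<lambda>x. - floor_cocycle s x) = ?c"
      unfolding bounded_cocycle_group_def by (simp only: monoid.simps)
    have c: "?c \<in> carrier (bounded_cocycle_group ?Z 2)"
      using N.m_closed[OF minus_floor_cocycle_carrier[of r] minus_floor_cocycle_carrier[of s]] unfolding mult .
    have "real_to_Hb2_int r \<otimes>\<^bsub>bounded_cohomology ?Z 2\<^esub> real_to_Hb2_int s = cohomology_class ?Z 2 ?c"
      using N.rcos_sum[OF minus_floor_cocycle_carrier[of r] minus_floor_cocycle_carrier[of s]] unfolding mult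
      by (simp only: real_to_Hb2_int_eq cohomology_class_def bounded_cohomology_def FactGroup_def monoid.simps)
    moreover have "(\<lambda>x. - floor_cocycle (r + s) x - ?c x) =
        coboundary ?Z 1 (cochain1 ?Z (\<lambda>k. floor_mult r k + floor_mult s k - floor_mult (r + s) k))"
      by (auto simp: fun_eq_iff coboundary_cochain1_Suc floor_cocycle_apply)
    moreover have "\<bar>floor_mult r k + floor_mult s k - floor_mult (r + s) k\<bar> \<le> 2" for k
      using floor_mult_bounds[of r k] floor_mult_bounds[of s k] floor_mult_bounds[of "r + s" k]
      unfolding distrib_right by linarith
    ultimately show ?thesis
      unfolding real_to_Hb2_int_eq
      using cohomology_class_eq_iff[OF group_integer_group minus_floor_cocycle_carrier c]
      by (simp add: real_to_Hb2_int_eq bounded_coboundaries_2_iff) blast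
  qed
  moreover have "real_to_Hb2_int r \<in> carrier (bounded_cohomology ?Z 2)" for r
    using minus_floor_cocycle_carrier[of r]
    by (auto simp: real_to_Hb2_int_eq cohomology_class_def bounded_cohomology_def FactGroup_def RCOSETS_def)
  moreover have "group real_add_group"
    by (rule groupI) (auto simp: real_add_group_def intro: exI[of _ "- x" for x])
  ultimately show ?thesis
    using group_bounded_cohomology_2[OF group_integer_group]
    by (simp add: group_hom_def group_hom_axioms_def hom_def real_add_group_def)
qed

theorem real_mod_int_to_Hb2_int_iso:
  "real_mod_int_to_Hb2_int \<in> iso real_mod_int (bounded_cohomology integer_group 2)"
proof -
  let ?Z = integer_group
  interpret H: group_hom real_add_group "bounded_cohomology ?Z 2" real_to_Hb2_int
    by (rule group_hom_real_to_Hb2_int)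
  have "kernel real_add_group (bounded_cohomology ?Z 2) real_to_Hb2_int = \<int>"
    by (auto simp: kernel_def real_to_Hb2_int_eq_one_iff bounded_cohomology_def FactGroup_def
        real_add_group_def)
  moreover have "real_to_Hb2_int ` carrier real_add_group = carrier (bounded_cohomology ?Z 2)"
  proof
    show "carrier (bounded_cohomology ?Z 2) \<subseteq> real_to_Hb2_int ` carrier real_add_group"
    proof
      fix X assume "X \<in> carrier (bounded_cohomology ?Z 2 :: (int list \<Rightarrow> int) set monoid)"
      then obtain c where c: "c \<in> carrier (bounded_cocycle_group ?Z 2)" "X = cohomology_class ?Z 2 c"
        by (auto simp: bounded_cohomology_def FactGroup_def RCOSETS_def cohomology_class_def)
      then obtain f B where f: "c = coboundary ?Z 1 (cochain1 ?Z f)" and B: "\<And>gs. \<bar>c gs\<bar> \<le> B"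
        using int_cocycle_coboundary[of c] by (auto simp: bounded_cocycle_group_def bounded_cochains_def)
      have "\<bar>(- f x) + (- f y) - (- f (x + y))\<bar> \<le> B" for x y
        using B[of "[x, y]"] by (simp add: f coboundary_cochain1_Suc tuples_def)
      from int_quasi_morphism_slope[of "\<lambda>x. - f x", OF this]
      obtain r C where C: "\<And>k. \<bar>- f k - floor_mult r k\<bar> \<le> C"
        by blast
      have "(\<lambda>x. - floor_cocycle r x - c x) =
          coboundary ?Z 1 (cochain1 ?Z (\<lambda>k. - f k - floor_mult r k))"
        by (auto simp: fun_eq_iff coboundary_cochain1_Suc floor_cocycle_apply f)
      then have "real_to_Hb2_int r = X"
        unfolding real_to_Hb2_int_eq c(2)
          cohomology_class_eq_iff[OF group_integer_group minus_floor_cocycle_carrier c(1)]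
          bounded_coboundaries_2_iff using C by blast
      then show "X \<in> real_to_Hb2_int ` carrier real_add_group"
        by (auto simp: real_add_group_def)
    qed
  qed auto
  ultimately show ?thesis
    using H.FactGroup_iso_set
    by (simp add: real_mod_int_def real_mod_int_to_Hb2_int_def[abs_def])
qed

end

theory Submission
  imports Defs
begin

text \<open>
  Choose a lift \<open>\<gamma>\<close> of \<open>g\<close> and put \<open>r = \<tau> \<gamma>\<close>.  The powers \<open>\<gamma>\<^sup>k\<close> lift the powers \<open>g\<^sup>k\<close>, and
  homogeneity gives \<open>\<lfloor>\<tau> (\<gamma>\<^sup>k)\<rfloor> = \<lfloor>r k\<rfloor>\<close>.  The Euler cocycle \<open>\<sigma>\<close> is computed from the values of
  \<open>\<lfloor>\<tau>\<rfloor>\<close> on arbitrary lifts, so its pullback along \<open>k \<mapsto> g\<^sup>k\<close> is the coboundary of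
  \<open>k \<mapsto> \<lfloor>r k\<rfloor>\<close>, as a cochain and not just up to a bounded coboundary.  Hence the pullback of
  \<open>[-\<sigma>]\<close> is the class that the identification assigns to \<open>r mod \<int>\<close>, and \<open>r mod \<int>\<close> is
  the rotation number of \<open>g\<close>.

  The computation takes place in an arbitrary central extension by \<open>\<int>\<close> with a homogeneous
  quasi-morphism \<open>\<tau>\<close> that is a translation on the kernel (\<open>pullback_bounded_euler_class\<close>); the
  symplectic group enters as the quotient of such an extension.  Most of the work is to justify
  the definitions by unique description.  The cocycle \<open>\<sigma>\<close> exists and is unique because the
  coboundary of a function that is equivariant under the kernel descends to the quotient
  (\<open>coboundary_descends\<close>).  It is bounded because \<open>\<lfloor>\<tau>\<rfloor>\<close> is close to \<open>\<tau>\<close>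
  (\<open>euler_cocycle_bounded\<close>).  The pullback of a class may be computed from any bounded
  representative (\<open>cohomology_pullback_class\<close>), and the rotation number from any lift, since two
  lifts differ by an element of the kernel (\<open>rotation_number_lift\<close>).
\<close>

section \<open>Pullback of bounded classes in degree two\<close>

lemma pair_in_tuples [simp]: "[x, y] \<in> tuples G 2 \<longleftrightarrow> x \<in> carrier G \<and> y \<in> carrier G"
  by (simp add: tuples_def)

lemma triple_in_tuples [simp]:
  "[x, y, z] \<in> tuples G 3 \<longleftrightarrow> x \<in> carrier G \<and> y \<in> carrier G \<and> z \<in> carrier G"
  by (simp add: tuples_def)

lemma tuples_2E:
  assumes "gs \<in> tuples G 2"
  obtains x y where "gs = [x, y]" "x \<in> carrier G" "y \<in> carrier G"
  using assms by (auto simp: tuples_Suc tuples_0 numeral_2_eq_2)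

lemma tuples_3E:
  assumes "gs \<in> tuples G 3"
  obtains x y z where "gs = [x, y, z]" "x \<in> carrier G" "y \<in> carrier G" "z \<in> carrier G"
  using assms by (auto simp: tuples_Suc tuples_0 numeral_3_eq_3)

lemma coboundary_cochain1_pair:
  assumes "group G" "x \<in> carrier G" "y \<in> carrier G"
  shows "coboundary G 1 (cochain1 G f) [x, y] = f x + f y - f (x \<otimes>\<^bsub>G\<^esub> y)"
  using assms by (simp only: coboundary_cochain1 pair_in_tuples) simp

lemma cochain_pullback_pair:
  "x \<in> carrier H \<Longrightarrow> y \<in> carrier H \<Longrightarrow> cochain_pullback H 2 \<phi> c [x, y] = c [\<phi> x, \<phi> y]"
  by (simp add: cochain_pullback_def)

lemma cochains_2_eqI:
  assumes "c \<in> cochains G 2" "d \<in> cochains G 2"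
    and "\<And>x y. x \<in> carrier G \<Longrightarrow> y \<in> carrier G \<Longrightarrow> c [x, y] = d [x, y]"
  shows "c = d"
proof
  fix gs
  show "c gs = d gs"
    using assms by (cases "gs \<in> tuples G 2") (auto simp: cochains_def elim: tuples_2E)
qed

lemma cochain_pullback_cochain: "cochain_pullback H k \<phi> c \<in> cochains H k"
  by (simp add: cochains_def cochain_pullback_def)

lemma coboundary_cochain: "coboundary G k c \<in> cochains G (k + 1)"
  by (simp add: cochains_def coboundary_def)

lemma coboundary_cochain1_cochain: "coboundary G 1 (cochain1 G f) \<in> cochains G 2"
  using coboundary_cochain[of G 1] by (simp add: numeral_2_eq_2)

lemma cochain_pullback_coboundary:
  assumes "group H" "group G" "\<phi> \<in> hom H G"
  shows "cochain_pullback H 2 \<phi> (coboundary G 1 (cochain1 G f))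
    = coboundary H 1 (cochain1 H (\<lambda>x. f (\<phi> x)))"
  by (rule cochains_2_eqI[OF cochain_pullback_cochain coboundary_cochain1_cochain])
    (simp only: cochain_pullback_pair coboundary_cochain1_pair assms
      hom_in_carrier[OF assms(3)] hom_mult[OF assms(3)])

lemma coboundary_cochain_pullback:
  assumes "group H" "\<phi> \<in> hom H G" "hs \<in> tuples H 3"
  shows "coboundary H 2 (cochain_pullback H 2 \<phi> c) hs = coboundary G 2 c (map \<phi> hs)"
proof -
  interpret H: group H by fact
  obtain x y z where "hs = [x, y, z]" "x \<in> carrier H" "y \<in> carrier H" "z \<in> carrier H"
    using assms(3) by (rule tuples_3E)
  then show ?thesis
    by (simp add: coboundary_2 cochain_pullback_pair hom_in_carrier[OF assms(2)] hom_mult[OF assms(2)])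
qed

lemma cochain_pullback_bounded_cocycle:
  assumes "group H" "\<phi> \<in> hom H G" "c \<in> carrier (bounded_cocycle_group G 2)"
  shows "cochain_pullback H 2 \<phi> c \<in> carrier (bounded_cocycle_group H 2)"
proof -
  have c: "c \<in> cocycles G 2" "c \<in> bounded_cochains G 2"
    using assms(3) by (auto simp: bounded_cocycle_group_def)
  then obtain B where B: "\<And>gs. \<bar>c gs\<bar> \<le> B"
    by (auto simp: bounded_cochains_def)
  have "coboundary H 2 (cochain_pullback H 2 \<phi> c) hs = 0" for hs
  proof (cases "hs \<in> tuples H 3")
    case True
    then show ?thesis
      using coboundary_cochain_pullback[OF assms(1,2) True, of c] c(1) by (simp add: cocycles_def)
  qed (simp add: coboundary_2)
  moreover have "\<bar>cochain_pullback H 2 \<phi> c hs\<bar> \<le> B" for hs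
    using B[of "map \<phi> hs"] abs_ge_zero order_trans by (auto simp: cochain_pullback_def)
  ultimately show ?thesis
    using cochain_pullback_cochain[of H 2 \<phi> c]
    by (auto simp: bounded_cocycle_group_def cocycles_def bounded_cochains_def)
qed

text \<open>Two representatives differ by the coboundary of a bounded function \<open>f\<close> on \<open>G\<close>, and their
  pullbacks by that of the bounded function \<open>f \<circ> \<phi>\<close>.\<close>

lemma cohomology_pullback_class:
  fixes c :: "'g list \<Rightarrow> 'a::linordered_idom"
  assumes "group H" "group G" "\<phi> \<in> hom H G" "c \<in> carrier (bounded_cocycle_group G 2)"
  shows "cohomology_pullback H 2 \<phi> (cohomology_class G 2 c)
    = cohomology_class H 2 (cochain_pullback H 2 \<phi> c)"
proof -
  interpret normal "bounded_coboundaries G 2 :: ('g list \<Rightarrow> 'a) set" "bounded_cocycle_group G 2"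
    by (rule normal_bounded_coboundaries_2) fact
  have "cohomology_class H 2 (cochain_pullback H 2 \<phi> d)
      = cohomology_class H 2 (cochain_pullback H 2 \<phi> c)"
    if d: "d \<in> cohomology_class G 2 c" for d
  proof -
    obtain h where h: "h \<in> bounded_coboundaries G 2" "d = h \<otimes>\<^bsub>bounded_cocycle_group G 2\<^esub> c"
      using d by (auto simp: cohomology_class_def r_coset_def)
    have d_carrier: "d \<in> carrier (bounded_cocycle_group G 2)"
      using h assms(4) by simp
    obtain f B where f: "h = coboundary G 1 (cochain1 G f)" and B: "\<And>x. x \<in> carrier G \<Longrightarrow> \<bar>f x\<bar> \<le> B"
      using h(1) by (auto simp: bounded_coboundaries_2_iff)
    have "(\<lambda>x. cochain_pullback H 2 \<phi> d x - cochain_pullback H 2 \<phi> c x) = cochain_pullback H 2 \<phi> h"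
      by (auto simp: fun_eq_iff cochain_pullback_def h(2) bounded_cocycle_group_def)
    also have "\<dots> = coboundary H 1 (cochain1 H (\<lambda>x. f (\<phi> x)))"
      unfolding f by (rule cochain_pullback_coboundary) fact+
    also have "\<dots> \<in> bounded_coboundaries H 2"
      unfolding bounded_coboundaries_2_iff using B assms(3) by (blast dest: hom_in_carrier)
    finally show ?thesis
      using cohomology_class_eq_iff[OF assms(1)] cochain_pullback_bounded_cocycle[OF assms(1,3)]
        d_carrier assms(4) by blast
  qed
  moreover have "c \<in> cohomology_class G 2 c"
    unfolding cohomology_class_def using assms(4) subgroup_axioms by (rule rcos_self)
  ultimately show ?thesis
    unfolding cohomology_pullback_def by (intro the_elem_image_unique) blast+
qed


section \<open>Descent of cocycles to the quotient of a central extension\<close>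

locale int_central_extension = E: group E + G: group G
  for E :: "('e, 'k) monoid_scheme" and G :: "('g, 'l) monoid_scheme" +
  fixes i :: "int \<Rightarrow> 'e" and p :: "'e \<Rightarrow> 'g"
  assumes extension: "central_extension_by_int i E p G"
begin

lemma p_hom: "p \<in> hom E G" and p_surj: "p ` carrier E = carrier G"
  using extension by (auto simp: central_extension_by_int_def)

sublocale p: group_hom E G p
  by unfold_locales (rule p_hom)

lemma liftE:
  assumes "x \<in> carrier G"
  obtains \<gamma> where "\<gamma> \<in> carrier E" "x = p \<gamma>"
  using assms unfolding p_surj[symmetric] by (rule imageE) (rule that)

lemma i_closed [simp]: "i a \<in> carrier E"
  using extension by (auto simp: central_extension_by_int_def hom_def Pi_iff)

lemma i_central: "\<gamma> \<in> carrier E \<Longrightarrow> i a \<otimes>\<^bsub>E\<^esub> \<gamma> = \<gamma> \<otimes>\<^bsub>E\<^esub> i a"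
  using extension by (auto simp: central_extension_by_int_def)

lemma lifts_differ_by_int:
  assumes "\<gamma> \<in> carrier E" "\<gamma>' \<in> carrier E" "p \<gamma> = p \<gamma>'"
  obtains a where "\<gamma>' = \<gamma> \<otimes>\<^bsub>E\<^esub> i a"
proof -
  have "inv\<^bsub>E\<^esub> \<gamma> \<otimes>\<^bsub>E\<^esub> \<gamma>' \<in> kernel E G p"
    using assms by (simp add: kernel_def)
  then obtain a where "inv\<^bsub>E\<^esub> \<gamma> \<otimes>\<^bsub>E\<^esub> \<gamma>' = i a"
    using extension by (metis central_extension_by_int_def rangeE)
  then have "\<gamma>' = \<gamma> \<otimes>\<^bsub>E\<^esub> i a"
    using assms by (metis E.inv_solve_left i_closed)
  then show thesis by (rule that)
qed

text \<open>Moving the two arguments by \<open>a\<close> and \<open>b\<close> moves their product by \<open>a + b\<close>, by centrality; so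
  the shifts cancel in \<open>f \<gamma> + f \<delta> - f (\<gamma> \<delta>)\<close>.\<close>

lemma equivariant_defect_invariant:
  fixes f :: "'e \<Rightarrow> 'a::linordered_idom"
  assumes equiv: "\<And>\<gamma> a. \<gamma> \<in> carrier E \<Longrightarrow> f (\<gamma> \<otimes>\<^bsub>E\<^esub> i a) = f \<gamma> + of_int a"
    and carrier: "\<gamma> \<in> carrier E" "\<gamma>' \<in> carrier E" "\<delta> \<in> carrier E" "\<delta>' \<in> carrier E"
    and lifts: "p \<gamma> = p \<gamma>'" "p \<delta> = p \<delta>'"
  shows "f \<gamma>' + f \<delta>' - f (\<gamma>' \<otimes>\<^bsub>E\<^esub> \<delta>') = f \<gamma> + f \<delta> - f (\<gamma> \<otimes>\<^bsub>E\<^esub> \<delta>)"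
proof -
  obtain a where a: "\<gamma>' = \<gamma> \<otimes>\<^bsub>E\<^esub> i a"
    using lifts_differ_by_int carrier lifts by blast
  obtain b where b: "\<delta>' = \<delta> \<otimes>\<^bsub>E\<^esub> i b"
    using lifts_differ_by_int carrier lifts by blast
  have "\<gamma>' \<otimes>\<^bsub>E\<^esub> \<delta>' = \<gamma> \<otimes>\<^bsub>E\<^esub> (i a \<otimes>\<^bsub>E\<^esub> \<delta>) \<otimes>\<^bsub>E\<^esub> i b"
    using carrier by (simp add: a b E.m_assoc)
  also have "\<dots> = \<gamma> \<otimes>\<^bsub>E\<^esub> \<delta> \<otimes>\<^bsub>E\<^esub> i a \<otimes>\<^bsub>E\<^esub> i b"
    using carrier by (simp only: i_central[of \<delta>] E.m_assoc E.m_closed i_closed)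
  finally show ?thesis
    using carrier by (simp add: a b equiv)
qed

text \<open>Evaluating the defect of \<open>f\<close> on a section of \<open>p\<close> gives a cochain on \<open>G\<close>; it does not depend
  on the section, which makes it a cocycle, and surjectivity of \<open>p\<close> makes it unique.\<close>

lemma coboundary_descends:
  fixes f :: "'e \<Rightarrow> 'a::linordered_idom"
  assumes equiv: "\<And>\<gamma> a. \<gamma> \<in> carrier E \<Longrightarrow> f (\<gamma> \<otimes>\<^bsub>E\<^esub> i a) = f \<gamma> + of_int a"
  shows "\<exists>!\<sigma>. \<sigma> \<in> cocycles G 2 \<and> cochain_pullback E 2 p \<sigma> = coboundary E 1 (cochain1 E f)"
proof (rule ex_ex1I)
  define s where "s = inv_into (carrier E) p"
  have s: "s x \<in> carrier E" "p (s x) = x" if "x \<in> carrier G" for x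
    using that p_surj by (auto simp: s_def inv_into_into f_inv_into_f)
  define \<sigma> where "\<sigma> = cochain_pullback G 2 s (coboundary E 1 (cochain1 E f))"
  have \<sigma>: "\<sigma> [p \<gamma>, p \<delta>] = f \<gamma> + f \<delta> - f (\<gamma> \<otimes>\<^bsub>E\<^esub> \<delta>)" if "\<gamma> \<in> carrier E" "\<delta> \<in> carrier E" for \<gamma> \<delta>
    using equivariant_defect_invariant[of f \<gamma> "s (p \<gamma>)" \<delta> "s (p \<delta>)", OF equiv] that
    unfolding \<sigma>_def by (simp only: p.hom_closed s cochain_pullback_pair coboundary_cochain1_pair[OF E.is_group])
  have pullback: "cochain_pullback E 2 p \<sigma> = coboundary E 1 (cochain1 E f)"
    by (rule cochains_2_eqI[OF cochain_pullback_cochain coboundary_cochain1_cochain])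
      (simp only: cochain_pullback_pair coboundary_cochain1_pair[OF E.is_group] \<sigma>)
  have "coboundary G 2 \<sigma> gs = 0" for gs
  proof (cases "gs \<in> tuples G 3")
    case True
    then have lift: "map s gs \<in> tuples E 3" "map p (map s gs) = gs"
      by (auto elim!: tuples_3E simp: s)
    then have "coboundary G 2 \<sigma> gs = coboundary E 2 (coboundary E 1 (cochain1 E f)) (map s gs)"
      using coboundary_cochain_pullback[OF E.is_group p_hom lift(1), of \<sigma>]
      unfolding pullback lift(2) by simp
    also have "\<dots> = 0"
      using coboundary_cochain1_cocycle[OF E.is_group, of f] by (simp add: cocycles_def)
    finally show ?thesis .
  qed (simp add: coboundary_2)
  then have "\<sigma> \<in> cocycles G 2"
    by (auto simp: cocycles_def \<sigma>_def cochain_pullback_cochain)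
  with pullback show "\<exists>\<sigma>. \<sigma> \<in> cocycles G 2 \<and> cochain_pullback E 2 p \<sigma> = coboundary E 1 (cochain1 E f)"
    by blast
next
  fix \<sigma> \<sigma>' :: "'g list \<Rightarrow> 'a"
  assume *: "\<sigma> \<in> cocycles G 2 \<and> cochain_pullback E 2 p \<sigma> = coboundary E 1 (cochain1 E f)"
    "\<sigma>' \<in> cocycles G 2 \<and> cochain_pullback E 2 p \<sigma>' = coboundary E 1 (cochain1 E f)"
  show "\<sigma> = \<sigma>'"
  proof (rule cochains_2_eqI)
    fix x y assume "x \<in> carrier G" "y \<in> carrier G"
    then obtain \<gamma> \<delta> where "\<gamma> \<in> carrier E" "\<delta> \<in> carrier E" "x = p \<gamma>" "y = p \<delta>"
      by (elim liftE)
    moreover have "cochain_pullback E 2 p \<sigma> [\<gamma>, \<delta>] = cochain_pullback E 2 p \<sigma>' [\<gamma>, \<delta>]"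
      using * by simp
    ultimately show "\<sigma> [x, y] = \<sigma>' [x, y]"
      by (simp add: cochain_pullback_pair)
  qed (use * in \<open>auto simp: cocycles_def\<close>)
qed

end


section \<open>The Euler class of a translation number\<close>

locale int_extension_translation = int_central_extension +
  fixes \<tau> :: "'a \<Rightarrow> real"
  assumes translation: "translation_number E i \<tau>"
begin

lemma \<tau>_int_pow: "\<gamma> \<in> carrier E \<Longrightarrow> \<tau> (\<gamma> [^]\<^bsub>E\<^esub> (m::int)) = of_int m * \<tau> \<gamma>"
  using translation by (simp add: translation_number_def homogeneous_quasi_morphism_def)

lemma \<tau>_equivariant: "\<gamma> \<in> carrier E \<Longrightarrow> \<tau> (\<gamma> \<otimes>\<^bsub>E\<^esub> i a) = \<tau> \<gamma> + of_int a"
  using translation by (simp add: translation_number_def)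

lemma \<tau>_defect_bounded:
  "\<exists>D. \<forall>\<gamma>\<in>carrier E. \<forall>\<delta>\<in>carrier E. \<bar>\<tau> \<gamma> + \<tau> \<delta> - \<tau> (\<gamma> \<otimes>\<^bsub>E\<^esub> \<delta>)\<bar> \<le> D"
proof -
  obtain D where D: "\<And>gs. \<bar>coboundary E 1 (cochain1 E \<tau>) gs\<bar> \<le> D"
    using translation
    by (auto simp: translation_number_def homogeneous_quasi_morphism_def quasi_morphism_def
        bounded_cochains_def)
  have "\<bar>\<tau> \<gamma> + \<tau> \<delta> - \<tau> (\<gamma> \<otimes>\<^bsub>E\<^esub> \<delta>)\<bar> \<le> D" if "\<gamma> \<in> carrier E" "\<delta> \<in> carrier E" for \<gamma> \<delta>
    using D[of "[\<gamma>, \<delta>]"] unfolding coboundary_cochain1_pair[OF E.is_group that] .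
  then show ?thesis by blast
qed

lemma euler_cocycle:
  shows euler_cocycle_cocycle: "euler_cocycle E p G \<tau> \<in> cocycles G 2"
    and euler_cocycle_pullback:
      "cochain_pullback E 2 p (euler_cocycle E p G \<tau>) = coboundary E 1 (cochain1 E (\<lambda>\<gamma>. \<lfloor>\<tau> \<gamma>\<rfloor>))"
proof -
  have "\<lfloor>\<tau> (\<gamma> \<otimes>\<^bsub>E\<^esub> i a)\<rfloor> = \<lfloor>\<tau> \<gamma>\<rfloor> + of_int a" if "\<gamma> \<in> carrier E" for \<gamma> a
    using that by (simp add: \<tau>_equivariant)
  from theI'[OF coboundary_descends[of "\<lambda>\<gamma>. \<lfloor>\<tau> \<gamma>\<rfloor>", OF this]]
  show "euler_cocycle E p G \<tau> \<in> cocycles G 2"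
    "cochain_pullback E 2 p (euler_cocycle E p G \<tau>) = coboundary E 1 (cochain1 E (\<lambda>\<gamma>. \<lfloor>\<tau> \<gamma>\<rfloor>))"
    unfolding euler_cocycle_def by blast+
qed

lemma euler_cocycle_lifts:
  assumes "\<gamma> \<in> carrier E" "\<delta> \<in> carrier E"
  shows "euler_cocycle E p G \<tau> [p \<gamma>, p \<delta>] = \<lfloor>\<tau> \<gamma>\<rfloor> + \<lfloor>\<tau> \<delta>\<rfloor> - \<lfloor>\<tau> (\<gamma> \<otimes>\<^bsub>E\<^esub> \<delta>)\<rfloor>"
  using fun_cong[OF euler_cocycle_pullback, of "[\<gamma>, \<delta>]"]
  unfolding coboundary_cochain1_pair[OF E.is_group assms] cochain_pullback_pair[OF assms] .

text \<open>Rounding changes the defect of \<open>\<tau>\<close> by less than 2.\<close>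

lemma euler_cocycle_bounded: "euler_cocycle E p G \<tau> \<in> bounded_cochains G 2"
proof -
  obtain D where D: "\<And>\<gamma> \<delta>. \<gamma> \<in> carrier E \<Longrightarrow> \<delta> \<in> carrier E \<Longrightarrow> \<bar>\<tau> \<gamma> + \<tau> \<delta> - \<tau> (\<gamma> \<otimes>\<^bsub>E\<^esub> \<delta>)\<bar> \<le> D"
    using \<tau>_defect_bounded by blast
  have D0: "D \<ge> 0"
    using D[OF E.one_closed E.one_closed] abs_ge_zero order_trans by blast
  have "\<bar>euler_cocycle E p G \<tau> gs\<bar> \<le> \<lceil>D\<rceil> + 2" for gs
  proof (cases "gs \<in> tuples G 2")
    case True
    then obtain \<gamma> \<delta> where \<gamma>\<delta>: "\<gamma> \<in> carrier E" "\<delta> \<in> carrier E" "gs = [p \<gamma>, p \<delta>]"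
      by (elim tuples_2E liftE) simp
    have "\<bar>\<lfloor>\<tau> \<gamma>\<rfloor> + \<lfloor>\<tau> \<delta>\<rfloor> - \<lfloor>\<tau> (\<gamma> \<otimes>\<^bsub>E\<^esub> \<delta>)\<rfloor>\<bar> \<le> \<lceil>D\<rceil> + 2"
      using D[OF \<gamma>\<delta>(1,2)] by linarith
    then show ?thesis
      by (simp add: \<gamma>\<delta>(3) euler_cocycle_lifts[OF \<gamma>\<delta>(1,2)])
  next
    case False
    then have "euler_cocycle E p G \<tau> gs = 0"
      using euler_cocycle_cocycle by (simp add: cocycles_def cochains_def)
    moreover have "0 \<le> \<lceil>D\<rceil>"
      using D0 by linarith
    ultimately show ?thesis by simp
  qed
  then show ?thesis
    using euler_cocycle_cocycle by (auto simp: cocycles_def bounded_cochains_def)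
qed

text \<open>The lifts \<open>\<gamma>\<^sup>k\<close> of the powers of \<open>p \<gamma>\<close> identify the pulled back cocycle with the coboundary of
  \<open>k \<mapsto> \<lfloor>\<tau> \<gamma> \<cdot> k\<rfloor>\<close>.  The two minus signs, in the bounded Euler class and in the identification
  with \<open>\<real>/\<int>\<close>, match.\<close>

lemma pullback_bounded_euler_class:
  assumes \<gamma>: "\<gamma> \<in> carrier E"
  shows "cohomology_pullback integer_group 2 (\<lambda>k::int. p \<gamma> [^]\<^bsub>G\<^esub> k) (bounded_euler_class E p G \<tau>)
    = real_to_Hb2_int (\<tau> \<gamma>)"
proof -
  let ?\<phi> = "\<lambda>k::int. p \<gamma> [^]\<^bsub>G\<^esub> k"
  have hom: "?\<phi> \<in> hom integer_group G"
    using \<gamma> by (auto simp: hom_def G.int_pow_mult)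
  have carrier: "(\<lambda>gs. - euler_cocycle E p G \<tau> gs) \<in> carrier (bounded_cocycle_group G 2)"
    using euler_cocycle_cocycle euler_cocycle_bounded
    by (simp add: bounded_cocycle_group_def cocycles_minus bounded_cochains_minus)
  have powers: "euler_cocycle E p G \<tau> [?\<phi> k, ?\<phi> l] =
      floor_mult (\<tau> \<gamma>) k + floor_mult (\<tau> \<gamma>) l - floor_mult (\<tau> \<gamma>) (k + l)" for k l
    using euler_cocycle_lifts[of "\<gamma> [^]\<^bsub>E\<^esub> k" "\<gamma> [^]\<^bsub>E\<^esub> l"] \<gamma>
    by (simp add: p.hom_int_pow floor_mult_def \<tau>_int_pow mult.commute flip: E.int_pow_mult)
  have "cochain_pullback integer_group 2 ?\<phi> (\<lambda>gs. - euler_cocycle E p G \<tau> gs)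
      = (\<lambda>x. - floor_cocycle (\<tau> \<gamma>) x)"
    by (auto simp: fun_eq_iff cochain_pullback_def floor_cocycle_apply powers elim!: tuples_2E)
  then show ?thesis
    unfolding bounded_euler_class_def real_to_Hb2_int_eq
      cohomology_pullback_class[OF group_integer_group G.is_group hom carrier] by simp
qed

end


section \<open>Reduction modulo the integers\<close>

lemma class_mod_int_eq: "class_mod_int r = {of_int m + r | m. True}"
  by (auto simp: class_mod_int_def r_coset_def real_add_group_def elim!: Ints_cases)

lemma class_mod_int_add_of_int: "class_mod_int (r + of_int a) = class_mod_int r"
proof -
  have "\<exists>m'. of_int m + r = of_int m' + (r + of_int a)" for m :: int
    by (rule exI[of _ "m - a"]) simp
  moreover have "\<exists>m'. of_int m + (r + of_int a) = of_int m' + r" for m :: int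
    by (rule exI[of _ "m + a"]) simp
  ultimately show ?thesis
    unfolding class_mod_int_eq by blast
qed

lemma real_to_Hb2_int_add_of_int: "real_to_Hb2_int (of_int m + r) = real_to_Hb2_int r"
proof -
  interpret group_hom real_add_group "bounded_cohomology integer_group 2" real_to_Hb2_int
    by (rule group_hom_real_to_Hb2_int)
  have "real_to_Hb2_int (of_int m) = \<one>\<^bsub>bounded_cohomology integer_group 2\<^esub>"
    by (simp add: real_to_Hb2_int_eq_one_iff bounded_cohomology_def FactGroup_def)
  then show ?thesis
    using hom_mult[of "of_int m" r] hom_closed[of r] by (simp add: real_add_group_def)
qed

lemma real_mod_int_to_Hb2_int_class: "real_mod_int_to_Hb2_int (class_mod_int r) = real_to_Hb2_int r"
  unfolding real_mod_int_to_Hb2_int_def class_mod_int_eq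
  by (intro the_elem_image_unique) (auto simp: real_to_Hb2_int_add_of_int)

lemma Hb2_int_to_real_mod_int_class: "Hb2_int_to_real_mod_int (real_to_Hb2_int r) = class_mod_int r"
proof -
  have "class_mod_int r \<in> carrier real_mod_int"
    by (auto simp: class_mod_int_def real_mod_int_def FactGroup_def RCOSETS_def real_add_group_def)
  moreover have "inj_on real_mod_int_to_Hb2_int (carrier real_mod_int)"
    using real_mod_int_to_Hb2_int_iso by (simp add: iso_def bij_betw_def)
  ultimately show ?thesis
    unfolding Hb2_int_to_real_mod_int_def
    by (metis inv_into_f_f real_mod_int_to_Hb2_int_class)
qed

lemma (in int_extension_translation) rotation_number_lift:
  assumes "\<gamma> \<in> carrier E"
  shows "rotation_number E p \<tau> (p \<gamma>) = class_mod_int (\<tau> \<gamma>)"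
  unfolding rotation_number_def
proof (rule the_elem_image_unique)
  show "{\<gamma>' \<in> carrier E. p \<gamma>' = p \<gamma>} \<noteq> {}"
    using assms by blast
  fix \<gamma>' assume "\<gamma>' \<in> {\<gamma>' \<in> carrier E. p \<gamma>' = p \<gamma>}"
  then obtain a where "\<gamma>' = \<gamma> \<otimes>\<^bsub>E\<^esub> i a"
    using lifts_differ_by_int[of \<gamma> \<gamma>'] assms by auto
  then show "class_mod_int (\<tau> \<gamma>') = class_mod_int (\<tau> \<gamma>)"
    using assms by (simp add: \<tau>_equivariant class_mod_int_add_of_int)
qed


section \<open>The symplectic group\<close>

lemma monoid_Sp: "Group.monoid Sp"
  by (rule monoidI) (auto simp: Sp_def matrix_mul_assoc simp flip: matrix_vector_mul_assoc)

text \<open>Inverses in \<open>G\<close> come from \<open>E\<close>, once units match: \<open>p\<close> takes the unit \<open>1\<close> of \<open>E\<close> to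
  that of \<open>G\<close> because, for an \<open>e\<close> that \<open>p\<close> maps to the unit of \<open>G\<close>, \<open>p 1 = p 1 \<cdot> p e = p e\<close>.\<close>

lemma group_surjective_hom_image:
  assumes "group E" "Group.monoid G" "p \<in> hom E G" "p ` carrier E = carrier G"
  shows "group G"
proof -
  interpret E: group E by fact
  interpret G: monoid G by fact
  have one: "p \<one>\<^bsub>E\<^esub> = \<one>\<^bsub>G\<^esub>"
  proof -
    obtain e where e: "e \<in> carrier E" "p e = \<one>\<^bsub>G\<^esub>"
      using assms(4) G.one_closed by (metis imageE)
    then have "p \<one>\<^bsub>E\<^esub> \<otimes>\<^bsub>G\<^esub> p e = p e"
      using hom_mult[OF assms(3), of "\<one>\<^bsub>E\<^esub>" e] by simp
    then show ?thesis
      using e hom_in_carrier[OF assms(3), of "\<one>\<^bsub>E\<^esub>"] by simp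
  qed
  show ?thesis
  proof (rule G.group_l_invI)
    fix x assume "x \<in> carrier G"
    then obtain e where e: "e \<in> carrier E" "x = p e"
      using assms(4) by blast
    then have "p (inv\<^bsub>E\<^esub> e) \<otimes>\<^bsub>G\<^esub> x = \<one>\<^bsub>G\<^esub>"
      using hom_mult[OF assms(3), of "inv\<^bsub>E\<^esub> e" e] one by simp
    then show "\<exists>y\<in>carrier G. y \<otimes>\<^bsub>G\<^esub> x = \<one>\<^bsub>G\<^esub>"
      using e hom_in_carrier[OF assms(3), of "inv\<^bsub>E\<^esub> e"] by blast
  qed
qed

theorem theorem1p2:
  fixes g :: "real^('n::finite + 'n)^('n + 'n)"
    and E :: "'e::topological_space monoid"
    and p :: "'e \<Rightarrow> real^('n + 'n)^('n + 'n)"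
    and i :: "int \<Rightarrow> 'e"
    and \<tau> :: "'e \<Rightarrow> real"
  assumes "universal_covering_group E p Sp"
    and "central_extension_by_int i E p Sp"
    and "translation_number E i \<tau>"
    and "g \<in> carrier Sp"
  shows "Hb2_int_to_real_mod_int
           (cohomology_pullback integer_group 2 (\<lambda>k::int. g [^]\<^bsub>Sp\<^esub> k)
             (bounded_euler_class E p Sp \<tau>))
         = rotation_number E p \<tau> g"
proof -
  have E: "group E"
    using assms(1) by (simp add: universal_covering_group_def topological_group_def)
  have p: "p \<in> hom E Sp" "p ` carrier E = carrier Sp"
    using assms(2) by (auto simp: central_extension_by_int_def)
  interpret int_extension_translation E Sp i p \<tau>
    using E group_surjective_hom_image[OF E monoid_Sp p] assms(2,3)
    by (intro int_extension_translation.intro int_central_extension.intro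
        int_central_extension_axioms.intro int_extension_translation_axioms.intro)
  obtain \<gamma> where "\<gamma> \<in> carrier E" "g = p \<gamma>"
    using assms(4) by (rule liftE)
  then show ?thesis
    by (simp add: pullback_bounded_euler_class rotation_number_lift Hb2_int_to_real_mod_int_class)
qed

end
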